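(* Let $N\ge 1$ and $d\ge 1$ be integers and let $m_0,m_1,\dots,m_N\ge 1$ be integers with $m_0=m_N=1$. Let $\mathcal H=(\mathbb C^d)^{\otimes N}$. Then the set $\mathrm{oMPS}(N,\{m_i\},d)\subseteq\mathcal H$ of normalized matrix product states with open boundary conditions and bond dimensions $\{m_i\}$ is closed in $\mathcal H$, and it coincides with the set of all normalized states $|\psi\rangle\in\mathcal H$ whose Schmidt rank $\tilde m_i$ with respect to the bipartition of the system into the blocks of sites $\{1,\dots,i\}$ and $\{i+1,\dots,N\}$ satisfies $\tilde m_i\le m_i$ for all $i\in\{1,\dots,N-1\}$.
   Context: The single-site Hilbert space $\mathbb C^d$ has orthonormal basis $\{|\sigma\rangle:\sigma=1,\dots,d\}$, and $\mathcal H=(\mathbb C^d)^{\otimes N}$ has the product basis $|\boldsymbol\sigma\rangle=|\sigma_1\rangle\otimes\dots\otimes|\sigma_N\rangle$. Closedness is with respect to the norm topology of the finite-dimensional space $\mathcal H$; normalized means $\|\psi\|=1$. $\mathrm{oMPS}(N,\{m_i\},d)$ is the set of all states $$|\Psi\rangle=\sum_{\boldsymbol\sigma}A_1^{\sigma_1}A_2^{\sigma_2}\cdots A_N^{\sigma_N}\,|\boldsymbol\sigma\rangle\quad\text{with } \|\Psi\|=1,$$ where each $A_i\in\mathbb C^{d\times m_{i-1}\times m_i}$ is an order-3 tensor, regarded as a collection of $m_{i-1}\times m_i$ matrices $A_i^1,\dots,A_i^d$ (so that, as $m_0=m_N=1$, the matrix product is a scalar). The Schmidt rank of $|\psi\rangle\in\mathcal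 H_{\mathcal A}\otimes\mathcal H_{\mathcal B}$ is the number of nonzero Schmidt coefficients, i.e. the rank of the coefficient matrix of $|\psi\rangle$ with respect to product bases of $\mathcal H_{\mathcal A}$ and $\mathcal H_{\mathcal B}$. *)

theory Defs
  imports "HOL-Analysis.Abstract_Metric_Spaces" "HOL-Analysis.L2_Norm"
    "Jordan_Normal_Form.DL_Rank"
begin

text \<open>
  A product basis vector of \<open>(\<complex>\<^sup>d)\<^sup>\<otimes>\<^sup>n\<close> is labelled by the list \<open>[\<sigma>\<^sub>1, \<dots>, \<sigma>\<^sub>n]\<close> with entries in
  \<open>{1..d}\<close>; \<^const>\<open>List.n_lists\<close> enumerates these labels without repetition.
\<close>

definition config_list :: "nat \<Rightarrow> nat \<Rightarrow> nat list list" where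
  "config_list n d = List.n_lists n [1..<Suc d]"

definition configs :: "nat \<Rightarrow> nat \<Rightarrow> nat list set" where
  "configs n d = {\<sigma>. length \<sigma> = n \<and> set \<sigma> \<subseteq> {1..d}}"

lemma set_config_list: "set (config_list n d) = configs n d"
  by (auto simp: config_list_def configs_def set_n_lists subset_eq less_Suc_eq_le)

lemma distinct_config_list: "distinct (config_list n d)"
  by (simp add: config_list_def distinct_n_lists del: upt_Suc)

lemma length_config_list: "length (config_list n d) = d ^ n"
  by (simp add: config_list_def length_n_lists del: upt_Suc)

lemma finite_configs [simp]: "finite (configs n d)"
  using set_config_list [of n d] by (metis finite_set)

text \<open>
  A state is its family of coefficients in the product basis. Coefficients at lists that are not
  labels are fixed to 0, so that equality of functions is equality of states.
\<close>

type_synonym state = "nat list \<Rightarrow> complex"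

definition hilbert :: "nat \<Rightarrow> nat \<Rightarrow> state set" where
  "hilbert N d = {\<psi>. \<forall>\<sigma>. \<sigma> \<notin> configs N d \<longrightarrow> \<psi> \<sigma> = 0}"

definition state_norm :: "nat \<Rightarrow> nat \<Rightarrow> state \<Rightarrow> real" where
  "state_norm N d \<psi> = L2_set (\<lambda>\<sigma>. cmod (\<psi> \<sigma>)) (configs N d)"

definition state_dist :: "nat \<Rightarrow> nat \<Rightarrow> state \<Rightarrow> state \<Rightarrow> real" where
  "state_dist N d \<psi> \<phi> = state_norm N d (\<lambda>\<sigma>. \<psi> \<sigma> - \<phi> \<sigma>)"

lemma Metric_space_hilbert: "Metric_space (hilbert N d) (state_dist N d)"
proof
  fix \<psi> \<phi> \<xi> :: state
  show "0 \<le> state_dist N d \<psi> \<phi>"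
    by (simp add: state_dist_def state_norm_def)
  show "state_dist N d \<psi> \<phi> = state_dist N d \<phi> \<psi>"
    by (simp add: state_dist_def state_norm_def norm_minus_commute)
  show "state_dist N d \<psi> \<phi> = 0 \<longleftrightarrow> \<psi> = \<phi>" if "\<psi> \<in> hilbert N d" "\<phi> \<in> hilbert N d"
    using that by (force simp: state_dist_def state_norm_def hilbert_def L2_set_eq_0_iff)
  have "state_dist N d \<psi> \<xi>
      \<le> L2_set (\<lambda>\<sigma>. cmod (\<psi> \<sigma> - \<phi> \<sigma>) + cmod (\<phi> \<sigma> - \<xi> \<sigma>)) (configs N d)"
    unfolding state_dist_def state_norm_def
    by (intro L2_set_mono) (auto simp: dist_triangle simp flip: dist_norm)
  also have "\<dots> \<le> state_dist N d \<psi> \<phi> + state_dist N d \<phi> \<xi>"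
    unfolding state_dist_def state_norm_def by (rule L2_set_triangle_ineq)
  finally show "state_dist N d \<psi> \<xi> \<le> state_dist N d \<psi> \<phi> + state_dist N d \<phi> \<xi>" .
qed

definition hilbert_topology :: "nat \<Rightarrow> nat \<Rightarrow> state topology" where
  "hilbert_topology N d = Metric_space.mtopology (hilbert N d) (state_dist N d)"

text \<open>
  The site tensor \<open>A\<^sub>i\<close> is the family \<open>A i s\<close>, \<open>s \<in> {1..d}\<close>, of matrices. Lists are 0-based, so
  \<open>\<sigma>\<^sub>i = \<sigma> ! (i - 1)\<close>. The empty product is the 1-by-1 identity, which is
  the right unit because matrix products are used with \<open>m 0 = 1\<close>.
\<close>

primrec mps_prod :: "(nat \<Rightarrow> nat \<Rightarrow> complex mat) \<Rightarrow> nat list \<Rightarrow> nat \<Rightarrow> complex mat" where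
  "mps_prod A \<sigma> 0 = 1\<^sub>m 1"
| "mps_prod A \<sigma> (Suc i) = mps_prod A \<sigma> i * A (Suc i) (\<sigma> ! i)"

definition mps_state :: "nat \<Rightarrow> nat \<Rightarrow> (nat \<Rightarrow> nat \<Rightarrow> complex mat) \<Rightarrow> state" where
  "mps_state N d A = (\<lambda>\<sigma>. if \<sigma> \<in> configs N d then mps_prod A \<sigma> N $$ (0, 0) else 0)"

definition oMPS :: "nat \<Rightarrow> (nat \<Rightarrow> nat) \<Rightarrow> nat \<Rightarrow> state set" where
  "oMPS N m d = {mps_state N d A | A.
     (\<forall>i\<in>{1..N}. \<forall>s\<in>{1..d}. A i s \<in> carrier_mat (m (i - 1)) (m i)) \<and>
     state_norm N d (mps_state N d A) = 1}"

text \<open>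
  Rows of the coefficient matrix are labelled by the configurations of sites \<open>1, \<dots>, i\<close>, columns by
  those of sites \<open>i + 1, \<dots>, N\<close>. The first argument of \<^const>\<open>vec_space.rank\<close> is the number of rows.
\<close>

definition coeff_mat :: "nat \<Rightarrow> nat \<Rightarrow> nat \<Rightarrow> state \<Rightarrow> complex mat" where
  "coeff_mat N d i \<psi> = mat (d ^ i) (d ^ (N - i))
     (\<lambda>(r, c). \<psi> (config_list i d ! r @ config_list (N - i) d ! c))"

definition schmidt_rank :: "nat \<Rightarrow> nat \<Rightarrow> nat \<Rightarrow> state \<Rightarrow> nat" where
  "schmidt_rank N d i \<psi> = vec_space.rank (d ^ i) (coeff_mat N d i \<psi>)"

end

theory Submission
  imports Defs
begin

text \<open>
  Both the matrix product form and the Schmidt rank bounds are statements about factorizations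
  \<open>\<psi> (\<sigma> @ \<tau>) = (\<Sum>k<m i. f k \<sigma> * g k \<tau>)\<close> at every cut \<open>i\<close>. Multiplying out the tensors on both sides of
  a cut gives such a factorization. Conversely, if \<open>f (i + 1)\<close> is chosen in the column space of the
  coefficient matrix, \<open>f (i + 1) k \<sigma> = (\<Sum>\<tau>. \<psi> (\<sigma> @ \<tau>) * h (i + 1) k \<tau>)\<close>, then inserting the
  factorization at cut \<open>i\<close> gives \<open>f (i + 1) k (\<sigma> @ [s]) = (\<Sum>l. f i l \<sigma> * A l k)\<close> with
  \<open>A l k = (\<Sum>\<tau>. g i l (s # \<tau>) * h (i + 1) k \<tau>)\<close>, which is the site tensor. For closedness, rank at most
  \<open>r\<close> passes to pointwise limits by induction on \<open>r\<close>: at a nonzero entry of the limit, pass to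
  Schur complements, which lowers the rank by one and is continuous.
\<close>

section \<open>Sums of \<open>r\<close> products, Schur complements and pointwise limits\<close>

text \<open>This is rank at most \<open>r\<close> for a matrix whose rows and columns are labelled
  by arbitrary sets, so no enumeration of configurations enters the limit argument.\<close>

definition factorable :: "nat \<Rightarrow> 'a set \<Rightarrow> 'b set \<Rightarrow> ('a \<Rightarrow> 'b \<Rightarrow> 'c::field) \<Rightarrow> bool" where
  "factorable r X Y M \<longleftrightarrow> (\<exists>f g. \<forall>x\<in>X. \<forall>y\<in>Y. M x y = (\<Sum>k<r. f k x * g k y))"

text \<open>Missing terms are padded by zero left factors. This admits index sets such as
  \<open>{..<Suc r}\<close> with one element removed.\<close>

lemma factorableI_card:
  fixes M :: "'a \<Rightarrow> 'b \<Rightarrow> 'c::field"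
  assumes "finite K" "card K \<le> r"
    and "\<And>x y. x \<in> X \<Longrightarrow> y \<in> Y \<Longrightarrow> M x y = (\<Sum>k\<in>K. f k x * g k y)"
  shows "factorable r X Y M"
proof -
  obtain e where e: "bij_betw e {..<card K} K"
    using ex_bij_betw_nat_finite[OF assms(1)] by (auto simp: lessThan_atLeast0)
  let ?f = "\<lambda>k x. if k < card K then f (e k) x else 0"
  have "M x y = (\<Sum>k<r. ?f k x * g (e k) y)" if "x \<in> X" "y \<in> Y" for x y
  proof -
    have "M x y = (\<Sum>k<card K. f (e k) x * g (e k) y)"
      using assms(3)[OF that] sum.reindex_bij_betw[OF e, of "\<lambda>k. f k x * g k y"] by simp
    also have "\<dots> = (\<Sum>k<r. ?f k x * g (e k) y)"
      using assms(2) by (intro sum.mono_neutral_cong_left) auto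
    finally show ?thesis .
  qed
  then show ?thesis unfolding factorable_def by (intro exI[of _ ?f] exI[of _ "\<lambda>k. g (e k)"]) simp
qed

text \<open>The subtracted expression is a function of \<open>x\<close> times a function of
  \<open>y\<close>, so it serves as the additional term.\<close>

lemma factorable_add_pivot:
  assumes "factorable r X Y (\<lambda>x y. M x y - M x y0 * M x0 y / M x0 y0)"
  shows "factorable (Suc r) X Y M"
proof -
  obtain f g where fg: "\<And>x y. x \<in> X \<Longrightarrow> y \<in> Y \<Longrightarrow>
      M x y - M x y0 * M x0 y / M x0 y0 = (\<Sum>k<r. f k x * g k y)"
    using assms unfolding factorable_def by blast
  let ?f = "\<lambda>k x. if k < r then f k x else M x y0"
  let ?g = "\<lambda>k y. if k < r then g k y else M x0 y / M x0 y0"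
  have "M x y = (\<Sum>k<Suc r. ?f k x * ?g k y)" if "x \<in> X" "y \<in> Y" for x y
    using fg[OF that] by (simp add: algebra_simps)
  then show ?thesis unfolding factorable_def by (intro exI[of _ ?f] exI[of _ ?g]) simp
qed

text \<open>Elimination at the pivot changes only the right factors. A nonzero pivot forces some
  \<open>f j x0\<close> to be nonzero, so the vanishing of row \<open>x0\<close> can be solved for
  the right factor with index \<open>j\<close>, and one term drops out.\<close>

lemma factorable_remove_pivot:
  assumes "factorable (Suc r) X Y M" "x0 \<in> X" "y0 \<in> Y" "M x0 y0 \<noteq> 0"
  shows "factorable r X Y (\<lambda>x y. M x y - M x y0 * M x0 y / M x0 y0)"
proof -
  obtain f g where fg: "\<And>x y. x \<in> X \<Longrightarrow> y \<in> Y \<Longrightarrow> M x y = (\<Sum>k<Suc r. f k x * g k y)"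
    using assms(1) unfolding factorable_def by blast
  have "\<exists>j<Suc r. f j x0 \<noteq> 0"
  proof (rule ccontr)
    assume "\<not> ?thesis"
    then have "M x0 y0 = 0" using fg[OF assms(2,3)] by (auto intro!: sum.neutral)
    with assms(4) show False by simp
  qed
  then obtain j where j: "j < Suc r" "f j x0 \<noteq> 0" by blast
  define g' where "g' k y = g k y - g k y0 * M x0 y / M x0 y0" for k y
  \<comment> \<open>Only \<open>M x y\<close> and \<open>M x y0\<close> are expanded; leaving
    \<open>M x0 y / M x0 y0\<close> as a scalar keeps \<open>f k x\<close> as the left
    factor.\<close>
  have schur: "M x y - M x y0 * M x0 y / M x0 y0 = (\<Sum>k<Suc r. f k x * g' k y)"
    if "x \<in> X" "y \<in> Y" for x y
    unfolding g'_def fg[OF that] fg[OF that(1) assms(3)]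
    by (simp only: right_diff_distrib sum_subtractf sum_divide_distrib sum_distrib_right
        times_divide_eq_right mult.assoc)
  \<comment> \<open>The row \<open>x0\<close> of the Schur complement vanishes, which makes \<open>g' j\<close> a combination of the others.\<close>
  let ?K = "{..<Suc r} - {j}"
  have split: "(\<Sum>k<Suc r. f k x * g' k y) = f j x * g' j y + (\<Sum>k\<in>?K. f k x * g' k y)" for x y
    using j(1) by (intro sum.remove) auto
  have elim: "g' j y = - (\<Sum>k\<in>?K. f k x0 * g' k y) / f j x0" if "y \<in> Y" for y
    using schur[OF assms(2) that] split[of x0 y] assms(4) j(2)
    by (simp add: field_simps eq_neg_iff_add_eq_0)
  show ?thesis
  proof (rule factorableI_card[where K = ?K])
    show "card ?K \<le> r" using j(1) by simp
    fix x y assume xy: "x \<in> X" "y \<in> Y"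
    show "M x y - M x y0 * M x0 y / M x0 y0
        = (\<Sum>k\<in>?K. (f k x - f j x * f k x0 / f j x0) * g' k y)"
      unfolding schur[OF xy] split elim[OF xy(2)]
      by (simp add: left_diff_distrib sum_subtractf sum_distrib_left sum_divide_distrib mult.assoc
        flip: sum_negf)
  qed simp
qed

text \<open>The factors of \<open>M n\<close> may diverge, so the limit cannot be taken in them. The
  Schur complement, however, is a function of the entries alone and is continuous wherever the pivot
  is nonzero.\<close>

lemma factorable_limit:
  fixes M :: "nat \<Rightarrow> 'a \<Rightarrow> 'b \<Rightarrow> 'c::real_normed_field"
  assumes "\<And>n. factorable r X Y (M n)"
    and "\<And>x y. x \<in> X \<Longrightarrow> y \<in> Y \<Longrightarrow> (\<lambda>n. M n x y) \<longlonglongrightarrow> L x y"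
  shows "factorable r X Y L"
  using assms
proof (induction r arbitrary: M L)
  case 0
  have "M n x y = 0" if "x \<in> X" "y \<in> Y" for n x y
    using 0(1) that unfolding factorable_def by auto
  then have "L x y = 0" if "x \<in> X" "y \<in> Y" for x y
    using 0(2)[OF that] that by (simp add: LIMSEQ_const_iff)
  then show ?case by (simp add: factorable_def)
next
  case (Suc r)
  show ?case
  proof (cases "\<forall>x\<in>X. \<forall>y\<in>Y. L x y = 0")
    case True
    then show ?thesis unfolding factorable_def
      by (intro exI[of _ "\<lambda>_ _. 0"]) simp
  next
    case False
    then obtain x0 y0 where p: "x0 \<in> X" "y0 \<in> Y" "L x0 y0 \<noteq> 0" by blast
    \<comment> \<open>A pivot of the limit is a pivot of all late members; the shift by
      \<open>n0\<close> discards the earlier ones, since the induction hypothesis asks for every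
      index.\<close>
    have "eventually (\<lambda>n. M n x0 y0 \<noteq> 0) sequentially"
      using tendsto_imp_eventually_ne[OF Suc.prems(2)] p by blast
    then obtain n0 where n0: "\<And>n. n \<ge> n0 \<Longrightarrow> M n x0 y0 \<noteq> 0"
      unfolding eventually_sequentially by blast
    let ?S = "\<lambda>M x y. M x y - M x y0 * M x0 y / M x0 y0 :: 'c"
    have "factorable r X Y (?S L)"
    proof (rule Suc.IH[where M = "\<lambda>n. ?S (M (n + n0))"])
      show "factorable r X Y (?S (M (n + n0)))" for n
        by (intro factorable_remove_pivot Suc.prems(1) p n0) simp
      fix x y assume xy: "x \<in> X" "y \<in> Y"
      have "(\<lambda>n. ?S (M n) x y) \<longlonglongrightarrow> ?S L x y"
        by (intro tendsto_intros Suc.prems(2) xy p)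
      then show "(\<lambda>n. ?S (M (n + n0)) x y) \<longlonglongrightarrow> ?S L x y"
        by (rule LIMSEQ_ignore_initial_segment)
    qed
    then show ?thesis by (rule factorable_add_pivot)
  qed
qed

section \<open>Matrix rank and factorizations\<close>

context vec_space begin

text \<open>By maximality: a column outside the span could be added to \<open>U\<close> without
  losing independence.\<close>

lemma cols_in_span_maximal:
  assumes "A \<in> carrier_mat n nc" "maximal U (\<lambda>T. T \<subseteq> set (cols A) \<and> lin_indpt T)"
  shows "set (cols A) \<subseteq> span U"
proof
  fix u assume u: "u \<in> set (cols A)"
  have carr: "set (cols A) \<subseteq> carrier_vec n" using assms(1) cols_dim by blast
  have U: "U \<subseteq> set (cols A)" "lin_indpt U" using assms(2) by (auto simp: maximal_def)
  show "u \<in> span U"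
  proof (rule ccontr)
    assume nin: "u \<notin> span U"
    have "u \<notin> U" using nin U(1) carr by (meson span_mem subset_trans)
    moreover have "lin_indpt (insert u U)"
      using lin_dep_iff_in_span[of U u] U carr u nin \<open>u \<notin> U\<close> by auto
    ultimately show False using assms(2) u U unfolding maximal_def by blast
  qed
qed

text \<open>The rank is the size of a maximal independent set of columns, and by Steinitz exchange
  such a set has at most as many elements as \<open>F\<close>.\<close>

lemma rank_le_if_cols_in_span:
  assumes A: "A \<in> carrier_mat n nc" and F: "finite F" "F \<subseteq> carrier_vec n" "set (cols A) \<subseteq> span F"
  shows "rank A \<le> card F"
proof -
  obtain U where U: "finite U" "maximal U (\<lambda>T. T \<subseteq> set (cols A) \<and> lin_indpt T)"
    using maximal_exists_superset[of "set (cols A)" "\<lambda>T. T \<subseteq> set (cols A) \<and> lin_indpt T" "{}"]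
    using finite_lin_indpt2 by force
  then have "lin_indpt U" "U \<subseteq> span F" using F(3) by (auto simp: maximal_def)
  from replacement[OF U(1) F(1) _ this] F(2) have "card U \<le> card F" by auto
  then show ?thesis using rank_card_indpt[OF A U(2)] by simp
qed

end

text \<open>Each column is a combination of the \<open>r\<close> vectors of values of the
  \<open>f k\<close>, with the values of the \<open>g k\<close> as coefficients, so the column space
  lies in their span.\<close>

lemma rank_le_if_factorable:
  fixes M :: "'a \<Rightarrow> 'b \<Rightarrow> 'c::field"
  assumes "factorable r (set xs) (set ys) M"
  shows "vec_space.rank (length xs)
    (mat (length xs) (length ys) (\<lambda>(i, j). M (xs ! i) (ys ! j))) \<le> r"
proof -
  interpret vec_space "TYPE('c)" "length xs" .
  let ?A = "mat (length xs) (length ys) (\<lambda>(i, j). M (xs ! i) (ys ! j))"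
  obtain f g where fg: "\<And>x y. x \<in> set xs \<Longrightarrow> y \<in> set ys \<Longrightarrow> M x y = (\<Sum>k<r. f k x * g k y)"
    using assms unfolding factorable_def by blast
  define F where "F = map (\<lambda>k. vec (length xs) (\<lambda>i. f k (xs ! i))) [0..<r]"
  have F: "set F \<subseteq> carrier_vec (length xs)" by (auto simp: F_def)
  have "col ?A j \<in> span (set F)" if "j < length ys" for j
  proof -
    have "col ?A j = mat_of_cols (length xs) F *\<^sub>v vec (length F) (\<lambda>k. g k (ys ! j))"
      by (rule eq_vecI) (use that in \<open>auto simp: fg F_def scalar_prod_def mat_of_cols_def
          lessThan_atLeast0\<close>)
    also have "\<dots> = lincomb_list (\<lambda>k. g k (ys ! j)) F"
      using F by (intro lincomb_list_as_mat_mult[symmetric]) auto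
    finally show ?thesis unfolding span_list_as_span[OF F, symmetric] span_list_def by auto
  qed
  then have "set (cols ?A) \<subseteq> span (set F)" by (auto simp: cols_def)
  then have "rank ?A \<le> card (set F)"
    by (intro rank_le_if_cols_in_span[where nc = "length ys"]) (use F in auto)
  also have "\<dots> \<le> r" using card_length[of F] by (simp add: F_def)
  finally show ?thesis .
qed

text \<open>A maximal independent set of columns supplies the left factors. Expressing them through
  \<open>M\<close> and coefficients \<open>h\<close> is what later allows the factorization at the
  preceding cut to be inserted.\<close>

lemma column_factorization_if_rank_le:
  fixes M :: "'a \<Rightarrow> 'b \<Rightarrow> 'c::field"
  assumes "vec_space.rank (length xs)
    (mat (length xs) (length ys) (\<lambda>(i, j). M (xs ! i) (ys ! j))) \<le> r"
  shows "\<exists>h g. \<forall>x\<in>set xs. \<forall>y\<in>set ys.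
    M x y = (\<Sum>k<r. (\<Sum>y'\<in>set ys. M x y' * h k y') * g k y)"
proof -
  interpret vec_space "TYPE('c)" "length xs" .
  let ?A = "mat (length xs) (length ys) (\<lambda>(i, j). M (xs ! i) (ys ! j))"
  define v where "v y = vec (length xs) (\<lambda>i. M (xs ! i) y)" for y
  have cols: "set (cols ?A) = v ` set ys"
    by (fastforce simp: cols_def v_def in_set_conv_nth image_iff intro: eq_vecI)
  obtain U where U: "finite U" "maximal U (\<lambda>T. T \<subseteq> set (cols ?A) \<and> lin_indpt T)"
    using maximal_exists_superset[of "set (cols ?A)" "\<lambda>T. T \<subseteq> set (cols ?A) \<and> lin_indpt T" "{}"]
    using finite_lin_indpt2 by force
  have card: "card U \<le> r" using assms rank_card_indpt[OF mat_carrier U(2)] by simp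
  have UY: "U \<subseteq> v ` set ys" using U(2) cols by (auto simp: maximal_def)
  then have Uc: "U \<subseteq> carrier_vec (length xs)" by (auto simp: v_def)
  \<comment> \<open>Distinct labels may carry equal columns, so \<open>K\<close> keeps one label for
    each vector in \<open>U\<close>.\<close>
  obtain K where K: "K \<subseteq> set ys" "inj_on v K" "v ` K = U"
    using iffD1[OF subset_image_inj UY] by blast
  have "\<exists>c. v y = lincomb c U" if "y \<in> set ys" for y
  proof -
    have "v y \<in> span U" using cols_in_span_maximal[OF mat_carrier U(2)] cols that by blast
    from finite_in_span[OF U(1) Uc this] show ?thesis by metis
  qed
  then obtain c where c: "\<And>y. y \<in> set ys \<Longrightarrow> v y = lincomb (c y) U" by metis
  have M: "M x y = (\<Sum>k\<in>K. M x k * c y (v k))" if xy: "x \<in> set xs" "y \<in> set ys" for x y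
  proof -
    obtain i where i: "i < length xs" "x = xs ! i" using xy(1) by (auto simp: in_set_conv_nth)
    have "M x y = lincomb (c y) U $ i" using c[OF xy(2), symmetric] i by (simp add: v_def)
    also have "\<dots> = (\<Sum>u\<in>U. c y u * u $ i)" by (rule lincomb_index[OF i(1) Uc])
    also have "\<dots> = (\<Sum>k\<in>K. M x k * c y (v k))"
      unfolding K(3)[symmetric] sum.reindex[OF K(2)] using i by (simp add: v_def mult.commute)
    finally show ?thesis .
  qed
  have finK: "finite K" using K(1) by (rule finite_subset) simp
  have cardK: "card K \<le> r" using card card_image[OF K(2)] K(3) by simp
  obtain e where e: "bij_betw e {..<card K} K"
    using ex_bij_betw_nat_finite[OF finK] by (auto simp: lessThan_atLeast0)
  \<comment> \<open>\<open>?h k\<close> is the indicator of the label \<open>e k\<close>; for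
    \<open>k \<ge> card K\<close> it is zero, which fills the sum up to \<open>r\<close>
    terms.\<close>
  let ?h = "\<lambda>k y. if k < card K \<and> y = e k then 1 else 0"
  have "M x y = (\<Sum>k<r. (\<Sum>y'\<in>set ys. M x y' * ?h k y') * c y (v (e k)))"
    if xy: "x \<in> set xs" "y \<in> set ys" for x y
  proof -
    have "M x y = (\<Sum>k<card K. M x (e k) * c y (v (e k)))"
      using M[OF xy] sum.reindex_bij_betw[OF e, of "\<lambda>k. M x k * c y (v k)"] by simp
    also have "\<dots> = (\<Sum>k<card K. (\<Sum>y'\<in>set ys. M x y' * ?h k y') * c y (v (e k)))"
    proof (rule sum.cong)
      fix k assume k: "k \<in> {..<card K}"
      then have "e k \<in> set ys" using e K(1) by (auto simp: bij_betw_def)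
      then have "M x (e k) = (\<Sum>y'\<in>set ys. if y' = e k then M x y' else 0)" by simp
      also have "\<dots> = (\<Sum>y'\<in>set ys. M x y' * ?h k y')" using k by (intro sum.cong) auto
      finally show "M x (e k) * c y (v (e k))
          = (\<Sum>y'\<in>set ys. M x y' * ?h k y') * c y (v (e k))"
        by (rule arg_cong)
    qed simp
    also have "\<dots> = (\<Sum>k<r. (\<Sum>y'\<in>set ys. M x y' * ?h k y') * c y (v (e k)))"
      using cardK by (intro sum.mono_neutral_left) auto
    finally show ?thesis .
  qed
  then show ?thesis by (intro exI[of _ ?h] exI[of _ "\<lambda>k y. c y (v (e k))"] ballI)
qed

section \<open>Schmidt rank as factorizability across a cut\<close>

lemma schmidt_rank_eq:
  "schmidt_rank N d i \<psi> = vec_space.rank (length (config_list i d))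
    (mat (length (config_list i d)) (length (config_list (N - i) d))
      (\<lambda>(r, c). \<psi> (config_list i d ! r @ config_list (N - i) d ! c)))"
  unfolding schmidt_rank_def coeff_mat_def length_config_list ..

lemma schmidt_rank_le_imp_factorization:
  assumes "schmidt_rank N d i \<psi> \<le> r"
  shows "\<exists>h g. \<forall>\<sigma>\<in>configs i d. \<forall>\<tau>\<in>configs (N - i) d. \<psi> (\<sigma> @ \<tau>)
    = (\<Sum>k<r. (\<Sum>\<tau>'\<in>configs (N - i) d. \<psi> (\<sigma> @ \<tau>') * h k \<tau>') * g k \<tau>)"
  using column_factorization_if_rank_le[OF assms[unfolded schmidt_rank_eq]] unfolding set_config_list .

lemma schmidt_rank_le_iff:
  "schmidt_rank N d i \<psi> \<le> r
    \<longleftrightarrow> factorable r (configs i d) (configs (N - i) d) (\<lambda>\<sigma> \<tau>. \<psi> (\<sigma> @ \<tau>))"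
proof
  assume "schmidt_rank N d i \<psi> \<le> r"
  from schmidt_rank_le_imp_factorization[OF this]
  obtain h g where "\<forall>\<sigma>\<in>configs i d. \<forall>\<tau>\<in>configs (N - i) d. \<psi> (\<sigma> @ \<tau>)
    = (\<Sum>k<r. (\<Sum>\<tau>'\<in>configs (N - i) d. \<psi> (\<sigma> @ \<tau>') * h k \<tau>') * g k \<tau>)" by blast
  then show "factorable r (configs i d) (configs (N - i) d) (\<lambda>\<sigma> \<tau>. \<psi> (\<sigma> @ \<tau>))"
    unfolding factorable_def
    by (intro exI[of _ "\<lambda>k \<sigma>. \<Sum>\<tau>'\<in>configs (N - i) d. \<psi> (\<sigma> @ \<tau>') * h k \<tau>'"] exI[of _ g])
next
  assume "factorable r (configs i d) (configs (N - i) d) (\<lambda>\<sigma> \<tau>. \<psi> (\<sigma> @ \<tau>))"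
  then show "schmidt_rank N d i \<psi> \<le> r"
    unfolding schmidt_rank_eq set_config_list[symmetric] by (rule rank_le_if_factorable)
qed

section \<open>Partial products and the Schmidt ranks of matrix product states\<close>

lemma configs_0 [simp]: "configs 0 d = {[]}"
  by (auto simp: configs_def)

lemma append_in_configs:
  "\<sigma> \<in> configs i d \<Longrightarrow> \<tau> \<in> configs n d \<Longrightarrow> \<sigma> @ \<tau> \<in> configs (i + n) d"
  by (auto simp: configs_def)

lemma take_in_configs: "\<sigma> \<in> configs N d \<Longrightarrow> i \<le> N \<Longrightarrow> take i \<sigma> \<in> configs i d"
  using set_take_subset[of i \<sigma>] by (auto simp: configs_def)

lemma nth_configs: "\<sigma> \<in> configs N d \<Longrightarrow> i < N \<Longrightarrow> \<sigma> ! i \<in> {1..d}"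
  using nth_mem[of i \<sigma>] subsetD[of "set \<sigma>" "{1..d}"] by (simp add: configs_def)

lemma Cons_in_configs: "s \<in> {1..d} \<Longrightarrow> \<tau> \<in> configs n d \<Longrightarrow> s # \<tau> \<in> configs (Suc n) d"
  by (auto simp: configs_def)

lemma mps_prod_append:
  "i \<le> length \<sigma> \<Longrightarrow> mps_prod A (\<sigma> @ \<tau>) i = mps_prod A \<sigma> i"
  by (induction i) (auto simp: nth_append)

lemma mps_prod_carrier:
  assumes "\<forall>i\<in>{1..N}. \<forall>s\<in>{1..d}. A i s \<in> carrier_mat (m (i - 1)) (m i)" "m 0 = 1"
    and "\<sigma> \<in> configs i d" "i \<le> N" "j \<le> i"
  shows "mps_prod A \<sigma> j \<in> carrier_mat 1 (m j)"
  using assms(5)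
proof (induction j)
  case 0
  then show ?case using assms(2) by simp
next
  case (Suc j)
  have "A (Suc j) (\<sigma> ! j) \<in> carrier_mat (m (Suc j - 1)) (m (Suc j))"
    using assms(1)[rule_format, OF _ nth_configs[OF assms(3)], of "Suc j" j] assms(4) Suc.prems
    by simp
  then show ?case using Suc by simp
qed

text \<open>\<open>G\<close> is the product of the \<open>n\<close> tensors following cut
  \<open>i\<close>, read along \<open>\<tau>\<close>. Since \<open>mps_prod\<close> grows at its
  right end, the induction removes the last letter of \<open>\<tau>\<close>. That one
  \<open>G\<close> serves all \<open>\<sigma>\<close> is what separates the two blocks.\<close>

lemma mps_prod_split:
  assumes A: "\<forall>i\<in>{1..N}. \<forall>s\<in>{1..d}. A i s \<in> carrier_mat (m (i - 1)) (m i)" and m0: "m 0 = 1"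
    and "i + n \<le> N" "\<tau> \<in> configs n d"
  shows "\<exists>G\<in>carrier_mat (m i) (m (i + n)).
    \<forall>\<sigma>\<in>configs i d. mps_prod A (\<sigma> @ \<tau>) (i + n) = mps_prod A \<sigma> i * G"
  using assms(3,4)
proof (induction n arbitrary: \<tau>)
  case 0
  have "mps_prod A \<sigma> i * 1\<^sub>m (m i) = mps_prod A \<sigma> i" if "\<sigma> \<in> configs i d" for \<sigma>
    by (rule right_mult_one_mat[OF mps_prod_carrier[OF A m0 that]]) (use 0 in auto)
  then show ?case using 0 by (intro bexI[of _ "1\<^sub>m (m i)"]) auto
next
  case (Suc n)
  obtain \<tau>' s where \<tau>: "\<tau> = \<tau>' @ [s]" "\<tau>' \<in> configs n d" "s \<in> {1..d}"
    using Suc.prems(2) by (cases \<tau> rule: rev_cases) (auto simp: configs_def)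
  obtain G where G: "G \<in> carrier_mat (m i) (m (i + n))"
    "\<And>\<sigma>. \<sigma> \<in> configs i d \<Longrightarrow> mps_prod A (\<sigma> @ \<tau>') (i + n) = mps_prod A \<sigma> i * G"
    using Suc.IH[OF _ \<tau>(2)] Suc.prems(1) by auto
  let ?B = "A (Suc (i + n)) s"
  have "Suc (i + n) \<in> {1..N}" using Suc.prems(1) by simp
  then have B: "?B \<in> carrier_mat (m (i + n)) (m (Suc (i + n)))"
    using A \<tau>(3) by fastforce
  have "mps_prod A (\<sigma> @ \<tau>) (i + Suc n) = mps_prod A \<sigma> i * (G * ?B)" if \<sigma>: "\<sigma> \<in> configs i d" for \<sigma>
  proof -
    have len: "length \<sigma> = i" "length \<tau>' = n" using \<sigma> \<tau>(2) by (auto simp: configs_def)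
    have "mps_prod A (\<sigma> @ \<tau>) (i + Suc n) = mps_prod A ((\<sigma> @ \<tau>') @ [s]) (i + n) * ?B"
      using len by (simp add: \<tau>(1) nth_append)
    also have "mps_prod A ((\<sigma> @ \<tau>') @ [s]) (i + n) = mps_prod A \<sigma> i * G"
      using len G(2)[OF \<sigma>] by (subst mps_prod_append) auto
    also have "mps_prod A \<sigma> i * G * ?B = mps_prod A \<sigma> i * (G * ?B)"
      using mps_prod_carrier[OF A m0 \<sigma>, of i] Suc.prems(1) by (intro assoc_mult_mat[OF _ G(1) B]) auto
    finally show ?thesis .
  qed
  then show ?case using G(1) B by (intro bexI[of _ "G * ?B"]) auto
qed

text \<open>The bond index at cut \<open>i\<close> is the summation index: a row vector from the
  left block meets the matrix of the right block, which is a single column because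
  \<open>m N = 1\<close>.\<close>

lemma schmidt_rank_mps_state_le:
  assumes A: "\<forall>i\<in>{1..N}. \<forall>s\<in>{1..d}. A i s \<in> carrier_mat (m (i - 1)) (m i)"
    and m: "m 0 = 1" "m N = 1" and i: "i \<le> N"
  shows "schmidt_rank N d i (mps_state N d A) \<le> m i"
proof -
  have "\<forall>\<tau>\<in>configs (N - i) d. \<exists>G\<in>carrier_mat (m i) 1.
      \<forall>\<sigma>\<in>configs i d. mps_prod A (\<sigma> @ \<tau>) N = mps_prod A \<sigma> i * G"
    using mps_prod_split[OF A m(1), of i "N - i"] i m(2) by simp
  then obtain G where G: "\<And>\<tau>. \<tau> \<in> configs (N - i) d \<Longrightarrow> G \<tau> \<in> carrier_mat (m i) 1"
    "\<And>\<sigma> \<tau>. \<tau> \<in> configs (N - i) d \<Longrightarrow> \<sigma> \<in> configs i d \<Longrightarrow>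
      mps_prod A (\<sigma> @ \<tau>) N = mps_prod A \<sigma> i * G \<tau>"
    by metis
  have "mps_state N d A (\<sigma> @ \<tau>) = (\<Sum>k<m i. mps_prod A \<sigma> i $$ (0, k) * G \<tau> $$ (k, 0))"
    if \<sigma>: "\<sigma> \<in> configs i d" and \<tau>: "\<tau> \<in> configs (N - i) d" for \<sigma> \<tau>
  proof -
    have "\<sigma> @ \<tau> \<in> configs N d" using append_in_configs[OF \<sigma> \<tau>] i by simp
    then show ?thesis
      using mps_prod_carrier[OF A m(1) \<sigma> i, of i] G(1)[OF \<tau>]
      by (simp add: mps_state_def G(2)[OF \<tau> \<sigma>] scalar_prod_def lessThan_atLeast0)
  qed
  then show ?thesis unfolding schmidt_rank_le_iff factorable_def
    by (intro exI[of _ "\<lambda>k \<sigma>. mps_prod A \<sigma> i $$ (0, k)"] exI[of _ "\<lambda>k \<tau>. G \<tau> $$ (k, 0)"]) simp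
qed

section \<open>Site tensors from factorizations at all cuts\<close>

text \<open>The site tensor acts as the transition matrix between the left factors at consecutive
  cuts, so the partial products, started at the value 1, run through these left factors.\<close>

lemma mps_prod_of_nested_factorizations:
  fixes f g h :: "nat \<Rightarrow> nat \<Rightarrow> nat list \<Rightarrow> complex"
  assumes m0: "m 0 = 1" and f0: "f 0 0 [] = 1"
    and fac: "\<And>i \<sigma> \<tau>. i \<le> N \<Longrightarrow> \<sigma> \<in> configs i d \<Longrightarrow> \<tau> \<in> configs (N - i) d \<Longrightarrow>
      \<psi> (\<sigma> @ \<tau>) = (\<Sum>k<m i. f i k \<sigma> * g i k \<tau>)"
    and col: "\<And>i k \<sigma>. 1 \<le> i \<Longrightarrow> i \<le> N \<Longrightarrow> k < m i \<Longrightarrow> \<sigma> \<in> configs i d \<Longrightarrow>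
      f i k \<sigma> = (\<Sum>\<tau>\<in>configs (N - i) d. \<psi> (\<sigma> @ \<tau>) * h i k \<tau>)"
    and A: "A = (\<lambda>i s. mat (m (i - 1)) (m i)
      (\<lambda>(l, k). \<Sum>\<tau>\<in>configs (N - i) d. g (i - 1) l (s # \<tau>) * h i k \<tau>))"
    and \<sigma>: "\<sigma> \<in> configs N d" and "i \<le> N" "k < m i"
  shows "mps_prod A \<sigma> i $$ (0, k) = f i k (take i \<sigma>)"
  using assms(7,8)
proof (induction i arbitrary: k)
  case 0
  then show ?case using m0 f0 by simp
next
  case (Suc i)
  have A_carrier: "\<forall>i\<in>{1..N}. \<forall>s\<in>{1..d}. A i s \<in> carrier_mat (m (i - 1)) (m i)"
    by (simp add: A)
  let ?T = "configs (N - Suc i) d"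
  have s: "\<sigma> ! i \<in> {1..d}" using nth_configs[OF \<sigma>] Suc.prems by simp
  have \<sigma>i: "take i \<sigma> \<in> configs i d" "take (Suc i) \<sigma> \<in> configs (Suc i) d"
    using take_in_configs[OF \<sigma>] Suc.prems by auto
  have snoc: "take (Suc i) \<sigma> = take i \<sigma> @ [\<sigma> ! i]"
    using \<sigma> Suc.prems by (intro take_Suc_conv_app_nth) (auto simp: configs_def)
  have "mps_prod A \<sigma> (Suc i) $$ (0, k)
      = (\<Sum>l<m i. mps_prod A \<sigma> i $$ (0, l) * A (Suc i) (\<sigma> ! i) $$ (l, k))"
    using mps_prod_carrier[where m = m, OF A_carrier m0 \<sigma>, of i] Suc.prems
    by (simp add: A scalar_prod_def lessThan_atLeast0)
  also have "\<dots> = (\<Sum>l<m i. f i l (take i \<sigma>) * (\<Sum>\<tau>\<in>?T. g i l (\<sigma> ! i # \<tau>) * h (Suc i) k \<tau>))"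
    using Suc by (intro sum.cong) (auto simp: A)
  also have "\<dots> = (\<Sum>\<tau>\<in>?T. (\<Sum>l<m i. f i l (take i \<sigma>) * g i l (\<sigma> ! i # \<tau>)) * h (Suc i) k \<tau>)"
    unfolding sum_distrib_left sum_distrib_right by (subst sum.swap) (simp add: mult.assoc)
  \<comment> \<open>The letter at position \<open>i\<close> changes sides: it belongs to the right
    block at cut \<open>i\<close> and to the left block at cut \<open>Suc i\<close>, while the whole
    configuration stays the same.\<close>
  also have "\<dots> = (\<Sum>\<tau>\<in>?T. \<psi> (take (Suc i) \<sigma> @ \<tau>) * h (Suc i) k \<tau>)"
  proof (intro sum.cong refl arg_cong2[where f = "(*)"])
    fix \<tau> assume "\<tau> \<in> ?T"
    then have "\<sigma> ! i # \<tau> \<in> configs (N - i) d"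
      using Cons_in_configs[OF s] Suc.prems by (metis Suc_diff_Suc Suc_le_lessD)
    then show "(\<Sum>l<m i. f i l (take i \<sigma>) * g i l (\<sigma> ! i # \<tau>)) = \<psi> (take (Suc i) \<sigma> @ \<tau>)"
      using fac[of i "take i \<sigma>" "\<sigma> ! i # \<tau>"] \<sigma>i Suc.prems by (simp add: snoc)
  qed
  also have "\<dots> = f (Suc i) k (take (Suc i) \<sigma>)"
    using col[OF _ _ _ \<sigma>i(2)] Suc.prems by simp
  finally show ?case .
qed

text \<open>The rank bounds give factorizations at the inner cuts, and \<open>m 0 = m N = 1\<close>
  gives one-term factorizations at the two ends. At cut \<open>N\<close> the partial product then
  returns the coefficient of \<open>\<psi>\<close>.\<close>

lemma mps_state_of_schmidt_rank_le:
  assumes "N \<ge> 1" and m: "m 0 = 1" "m N = 1" and \<psi>: "\<psi> \<in> hilbert N d"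
    and rank: "\<And>i. i \<in> {1..N - 1} \<Longrightarrow> schmidt_rank N d i \<psi> \<le> m i"
  shows "\<exists>A. (\<forall>i\<in>{1..N}. \<forall>s\<in>{1..d}. A i s \<in> carrier_mat (m (i - 1)) (m i)) \<and>
    \<psi> = mps_state N d A"
proof -
  \<comment> \<open>At cut 0 the row vector \<open>f\<close> has to be the empty product 1 rather than a column of the coefficient
    matrix; at cut \<open>N\<close> the choice \<open>h = 1\<close> makes \<open>f\<close> equal to \<open>\<psi>\<close>.\<close>
  define f where "f h i k \<sigma> = (if i = 0 then 1
    else \<Sum>\<tau>\<in>configs (N - i) d. \<psi> (\<sigma> @ \<tau>) * h k \<tau>)" for h :: "nat \<Rightarrow> nat list \<Rightarrow> complex" and i k \<sigma>
  define P where "P i h g \<longleftrightarrow> (i = N \<longrightarrow> h = (\<lambda>_ _. 1)) \<and>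
    (\<forall>\<sigma>\<in>configs i d. \<forall>\<tau>\<in>configs (N - i) d. \<psi> (\<sigma> @ \<tau>) = (\<Sum>k<m i. f h i k \<sigma> * g k \<tau>))" for i h g
  have "\<exists>h g. P i h g" if "i \<le> N" for i
  proof -
    consider "i = 0" | "i = N" | "i \<in> {1..N - 1}" using \<open>i \<le> N\<close> by fastforce
    then show ?thesis
    proof cases
      case 1
      have "\<forall>\<sigma>\<in>configs i d. \<forall>\<tau>\<in>configs (N - i) d.
          \<psi> (\<sigma> @ \<tau>) = (\<Sum>k<m i. f (\<lambda>_ _. 1) i k \<sigma> * \<psi> \<tau>)"
        using 1 m by (simp add: f_def)
      then have "P i (\<lambda>_ _. 1) (\<lambda>_. \<psi>)" by (simp add: P_def)
      then show ?thesis by blast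
    next
      case 2
      have "\<forall>\<sigma>\<in>configs i d. \<forall>\<tau>\<in>configs (N - i) d.
          \<psi> (\<sigma> @ \<tau>) = (\<Sum>k<m i. f (\<lambda>_ _. 1) i k \<sigma> * 1)"
        using 2 m \<open>N \<ge> 1\<close> by (simp add: f_def)
      then have "P i (\<lambda>_ _. 1) (\<lambda>_ _. 1)" by (simp add: P_def)
      then show ?thesis by blast
    next
      case 3
      then have "i \<noteq> 0" "i \<noteq> N" by auto
      from schmidt_rank_le_imp_factorization[OF rank[OF 3]]
      obtain h g where "\<forall>\<sigma>\<in>configs i d. \<forall>\<tau>\<in>configs (N - i) d.
          \<psi> (\<sigma> @ \<tau>) = (\<Sum>k<m i. f h i k \<sigma> * g k \<tau>)"
        using \<open>i \<noteq> 0\<close> by (simp add: f_def) blast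
      with \<open>i \<noteq> N\<close> have "P i h g" by (simp add: P_def)
      then show ?thesis by blast
    qed
  qed
  then obtain h g where P: "\<And>i. i \<le> N \<Longrightarrow> P i (h i) (g i)" by metis
  \<comment> \<open>The choice of \<open>h\<close> hides how each cut was treated; the first
    conjunct of \<open>P\<close> preserves its value at cut \<open>N\<close>.\<close>
  have hN: "h N = (\<lambda>_ _. 1)" using P[of N] by (simp add: P_def)
  have fac: "\<psi> (\<sigma> @ \<tau>) = (\<Sum>k<m i. f (h i) i k \<sigma> * g i k \<tau>)"
    if "i \<le> N" "\<sigma> \<in> configs i d" "\<tau> \<in> configs (N - i) d" for i \<sigma> \<tau>
    using P[OF that(1)] that(2,3) unfolding P_def by blast
  define A where "A = (\<lambda>i s. mat (m (i - 1)) (m i)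
    (\<lambda>(l, k). \<Sum>\<tau>\<in>configs (N - i) d. g (i - 1) l (s # \<tau>) * h i k \<tau>))"
  have "mps_state N d A \<sigma> = \<psi> \<sigma>" for \<sigma>
  proof (cases "\<sigma> \<in> configs N d")
    case True
    have "mps_prod A \<sigma> N $$ (0, 0) = f (h N) N 0 (take N \<sigma>)"
    proof (rule mps_prod_of_nested_factorizations[where \<psi> = \<psi> and f = "\<lambda>i. f (h i) i" and g = g,
          OF m(1) _ _ _ A_def True])
      show "f (h 0) 0 0 [] = 1" by (simp add: f_def)
      show "\<psi> (\<rho> @ \<tau>) = (\<Sum>k<m i. f (h i) i k \<rho> * g i k \<tau>)"
        if "i \<le> N" "\<rho> \<in> configs i d" "\<tau> \<in> configs (N - i) d" for i \<rho> \<tau>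
        using that by (rule fac)
      show "f (h i) i k \<rho> = (\<Sum>\<tau>\<in>configs (N - i) d. \<psi> (\<rho> @ \<tau>) * h i k \<tau>)" if "1 \<le> i" for i k \<rho>
        using that by (simp add: f_def)
    qed (simp_all add: m(2))
    also have "\<dots> = \<psi> \<sigma>"
    proof -
      have "length \<sigma> = N" using True by (simp add: configs_def)
      then show ?thesis using hN \<open>N \<ge> 1\<close> by (simp add: f_def)
    qed
    finally show ?thesis using True by (simp add: mps_state_def)
  next
    case False
    then show ?thesis using \<psi> by (simp add: mps_state_def hilbert_def)
  qed
  then show ?thesis by (intro exI[of _ A]) (auto simp: A_def)
qed

section \<open>Characterization and closedness of the set of matrix product states\<close>

lemma oMPS_eq:
  assumes "N \<ge> 1" "m 0 = 1" "m N = 1"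
  shows "oMPS N m d = {\<psi> \<in> hilbert N d. state_norm N d \<psi> = 1 \<and>
      (\<forall>i\<in>{1..N - 1}. schmidt_rank N d i \<psi> \<le> m i)}" (is "_ = ?R")
proof
  show "oMPS N m d \<subseteq> ?R"
    using schmidt_rank_mps_state_le[OF _ assms(2,3)]
    by (fastforce simp: oMPS_def hilbert_def mps_state_def)
  show "?R \<subseteq> oMPS N m d"
  proof
    fix \<psi> assume \<psi>: "\<psi> \<in> ?R"
    then obtain A where "\<forall>i\<in>{1..N}. \<forall>s\<in>{1..d}. A i s \<in> carrier_mat (m (i - 1)) (m i)"
      "\<psi> = mps_state N d A"
      using mps_state_of_schmidt_rank_le[OF assms] by blast
    then show "\<psi> \<in> oMPS N m d" using \<psi> unfolding oMPS_def by blast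
  qed
qed

text \<open>The distance dominates every coefficient difference, so convergent sequences converge
  coefficientwise. The norm is continuous in the finitely many coefficients, and the rank bounds
  survive by \<open>factorable_limit\<close>.\<close>

lemma closedin_schmidt_rank_le:
  "closedin (hilbert_topology N d) {\<psi> \<in> hilbert N d. state_norm N d \<psi> = 1 \<and>
      (\<forall>i\<in>{1..N - 1}. schmidt_rank N d i \<psi> \<le> m i)}" (is "closedin _ ?R")
proof -
  interpret Metric_space "hilbert N d" "state_dist N d" by (rule Metric_space_hilbert)
  have "\<phi> \<in> ?R" if \<psi>: "range \<psi> \<subseteq> ?R" and lim: "limitin mtopology \<psi> \<phi> sequentially" for \<psi> \<phi>
  proof -
    have \<phi>: "\<phi> \<in> hilbert N d" and dist: "(\<lambda>n. state_dist N d (\<psi> n) \<phi>) \<longlonglongrightarrow> 0"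
      using lim by (auto simp: limitin_metric_dist_null)
    have conv: "(\<lambda>n. \<psi> n \<sigma>) \<longlonglongrightarrow> \<phi> \<sigma>" if "\<sigma> \<in> configs N d" for \<sigma>
    proof -
      have "cmod (\<psi> n \<sigma> - \<phi> \<sigma>) \<le> state_dist N d (\<psi> n) \<phi>" for n
        unfolding state_dist_def state_norm_def
        by (rule member_le_L2_set[OF finite_configs that])
      then have "(\<lambda>n. \<psi> n \<sigma> - \<phi> \<sigma>) \<longlonglongrightarrow> 0"
        by (intro Lim_null_comparison[OF _ dist]) simp
      then show ?thesis by (simp add: LIM_zero_iff)
    qed
    have "(\<lambda>n. state_norm N d (\<psi> n)) \<longlonglongrightarrow> state_norm N d \<phi>"
      unfolding state_norm_def L2_set_def by (intro tendsto_intros conv)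
    moreover have "state_norm N d (\<psi> n) = 1" for n using \<psi> by blast
    ultimately have "state_norm N d \<phi> = 1" by (simp add: LIMSEQ_const_iff)
    \<comment> \<open>The rank may drop in the limit but cannot rise above a common bound.\<close>
    moreover have "schmidt_rank N d i \<phi> \<le> m i" if i: "i \<in> {1..N - 1}" for i
      unfolding schmidt_rank_le_iff
    proof (rule factorable_limit)
      show "factorable (m i) (configs i d) (configs (N - i) d) (\<lambda>\<sigma> \<tau>. \<psi> n (\<sigma> @ \<tau>))" for n
        unfolding schmidt_rank_le_iff[symmetric] using \<psi> i by blast
      fix \<sigma> \<tau> assume "\<sigma> \<in> configs i d" "\<tau> \<in> configs (N - i) d"
      then have "\<sigma> @ \<tau> \<in> configs N d" using append_in_configs[of \<sigma> i d \<tau> "N - i"] i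
        by (auto simp: le_diff_conv2)
      then show "(\<lambda>n. \<psi> n (\<sigma> @ \<tau>)) \<longlonglongrightarrow> \<phi> (\<sigma> @ \<tau>)" by (rule conv)
    qed
    ultimately show ?thesis using \<phi> by blast
  qed
  then show ?thesis unfolding hilbert_topology_def metric_closedin_iff_sequentially_closed by blast
qed

theorem proposition1:
  fixes N d :: nat and m :: "nat \<Rightarrow> nat"
  assumes "N \<ge> 1" and "d \<ge> 1"
    and "\<And>i. i \<le> N \<Longrightarrow> m i \<ge> 1"
    and "m 0 = 1" and "m N = 1"
  shows "closedin (hilbert_topology N d) (oMPS N m d) \<and>
    oMPS N m d = {\<psi> \<in> hilbert N d. state_norm N d \<psi> = 1 \<and>
      (\<forall>i\<in>{1..N - 1}. schmidt_rank N d i \<psi> \<le> m i)}"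
  using oMPS_eq[OF assms(1,4,5)] closedin_schmidt_rank_le by simp

end
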